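(* Let $A$ be a real symmetric positive definite $n\times n$ matrix and let $B := A^{-1}\circ A^{-1}$ be the Hadamard (elementwise) product of $A^{-1}$ with itself (so $B$ is positive definite with nonnegative entries). Let $\bar d\in\mathbb{R}^n_{++}$, with $\bar D=\operatorname{Diag}(\bar d)$, be the solution of $$B\bar d = \operatorname{diag}(\bar D^{-1})>0,$$ i.e. $(B\bar d)_i = 1/\bar d_i$ for all $i=1,\dots,n$, and let $D=\bar D^{1/2}$, $d=\operatorname{diag}(D)$. Then $\bar d^TB\bar d=n$. Moreover, $d$ provides the $\omega$-optimal diagonal scaling with respect to $A^{-2}$, in the sense that $$d \in \operatorname*{argmin}_{d\in\mathbb{R}^n_{++},\; D=\operatorname{Diag}(d)} \ \omega\left(D A^{-1} D D A^{-1} D\right),$$ and the corresponding optimal scaling (preconditioning) of a linear system $Ax=b$ is $(D^{-1}AD^{-1})(Dx)=D^{-1}b$.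
   Context: For a real symmetric positive definite $n\times n$ matrix $M$, the $\omega$-condition number is $\omega(M)=\dfrac{\operatorname{trace}(M)/n}{\det(M)^{1/n}}$ (ratio of the arithmetic and geometric means of the eigenvalues). $\mathbb{R}^n_{++}$ is the set of vectors with all entries positive. $\operatorname{Diag}(v)$ is the diagonal matrix with diagonal $v$, and $\operatorname{diag}(M)$ is the vector of diagonal entries of $M$. *)

theory Defs
  imports "HOL-Analysis.Analysis"
begin

definition pos_def :: "real^'n^'n \<Rightarrow> bool" where
  "pos_def M \<longleftrightarrow> transpose M = M \<and> (\<forall>x. x \<noteq> 0 \<longrightarrow> x \<bullet> (M *v x) > 0)"

definition pos_semidef :: "real^'n^'n \<Rightarrow> bool" where
  "pos_semidef M \<longleftrightarrow> transpose M = M \<and> (\<forall>x. x \<bullet> (M *v x) \<ge> 0)"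

definition Diag :: "real^'n \<Rightarrow> real^'n^'n" where
  "Diag v = (\<chi> i j. if i = j then v $ i else 0)"

definition diag :: "real^'n^'n \<Rightarrow> real^'n" where
  "diag M = (\<chi> i. M $ i $ i)"

definition pos_vecs :: "(real^'n) set" where
  "pos_vecs = {v. \<forall>i. v $ i > 0}"

(* On type vec, * acts entrywise (and recursively so on vectors of vectors), hence on
   matrices it is the Hadamard product; the matrix product is **. *)
abbreviation hadamard :: "real^'n^'n \<Rightarrow> real^'n^'n \<Rightarrow> real^'n^'n"
    (infixl "\<circ>\<^sub>H" 70) where
  "M \<circ>\<^sub>H N \<equiv> M * N"

(* The principal square root M^(1/2), well defined for every positive semidefinite M. *)
definition mat_sqrt :: "real^'n^'n \<Rightarrow> real^'n^'n" where
  "mat_sqrt M = (THE S. pos_semidef S \<and> S ** S = M)"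

(* Only meaningful for positive definite M. *)
definition omega :: "real^'n^'n \<Rightarrow> real" where
  "omega M = (trace M / real CARD('n)) / root CARD('n) (det M)"

(* The coefficient matrix of the system A x = b scaled symmetrically by D^(-1). *)
definition scaled :: "real^'n^'n \<Rightarrow> real^'n^'n \<Rightarrow> real^'n^'n" where
  "scaled D A = matrix_inv D ** A ** matrix_inv D"

end

theory Submission
  imports Defs
begin

text \<open>
  Put \<open>C = A\<^sup>-\<^sup>1\<close>, \<open>B = C \<circ>\<^sub>H C\<close> and, for a positive scaling vector \<open>e\<close>,
  \<open>w = e * e\<close>. The trace of \<open>(Diag e C Diag e)\<^sup>2\<close> is the quadratic form \<open>w \<bullet> (B *v w)\<close>
  and its determinant is \<open>(\<Prod>i. w $ i)\<^sup>2 (det C)\<^sup>2\<close>. Minimising omega therefore means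
  minimising \<open>w \<bullet> (B *v w)\<close> relative to the geometric mean of the entries of \<open>w\<close>, a
  problem invariant under rescaling of \<open>w\<close>; the equations \<open>(B *v v) $ i = 1 / v $ i\<close>
  are its stationarity conditions, normalised by \<open>v \<bullet> (B *v v) = n\<close>.

  Every positive solution \<open>v\<close> of these equations is a global minimiser
  (\<open>scaling_inequality\<close>). Indeed, the numbers \<open>v $ i * B $ i $ j * v $ j\<close> are nonnegative
  with all row and column sums equal to 1. Writing \<open>w $ i = s i * v $ i\<close>, the form
  \<open>w \<bullet> (B *v w)\<close> is \<open>n\<close> times an average of the products \<open>s i * s j\<close> with these weights,
  and the weighted inequality of arithmetic and geometric means bounds it from below.
  Since \<open>omega\<close> sees the scaling only through its squared entries, the optimal \<open>d\<close> is the
  entrywise square root of \<open>v\<close>, which is the diagonal of the principal square root of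
  \<open>Diag v\<close> (\<open>mat_sqrt_Diag\<close>).

  A solution exists because the product of the entries attains a maximum on the compact set
  of nonnegative \<open>v\<close> with \<open>v \<bullet> (B *v v) \<le> n\<close> (\<open>optimal_scaling_exists\<close>). It is unique
  because \<open>B *v v\<close> is strictly monotone in \<open>v\<close>, by positive definiteness of \<open>B\<close>, while the
  entrywise reciprocal is antitone (\<open>optimal_scaling_unique\<close>). Positive definiteness of
  \<open>B\<close> is the Schur product theorem (\<open>schur_product_pos_def\<close>), which rests on writing a
  positive definite matrix as a Gram matrix.
\<close>

section \<open>Diagonal matrices and inverses\<close>

lemma Diag_component [simp]: "Diag v $ i $ j = (if i = j then v $ i else 0)"
  by (simp add: Diag_def)

lemma diag_component [simp]: "diag M $ i = M $ i $ i"
  by (simp add: diag_def)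

lemma Diag_mult_component [simp]: "(Diag v ** M) $ i $ j = v $ i * M $ i $ j"
  by (simp add: matrix_matrix_mult_def if_distrib if_distribR cong: if_cong)

lemma mult_Diag_component [simp]: "(M ** Diag v) $ i $ j = M $ i $ j * v $ j"
  by (simp add: matrix_matrix_mult_def if_distrib if_distribR cong: if_cong)

lemma quadratic_form_sum:
  "x \<bullet> (M *v y) = (\<Sum>i\<in>UNIV. \<Sum>j\<in>UNIV. x $ i * M $ i $ j * y $ j)" for M :: "real^'n^'n"
  by (simp add: inner_vec_def matrix_vector_mult_def sum_distrib_left mult.assoc)

lemma matrix_inv_inverse:
  fixes M :: "real^'n^'n"
  assumes "invertible M"
  shows matrix_inv_right: "M ** matrix_inv M = mat 1"
    and matrix_inv_left: "matrix_inv M ** M = mat 1"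
  using someI_ex[OF assms[unfolded invertible_def]] by (auto simp: matrix_inv_def)

lemma matrix_inv_eqI:
  fixes M N :: "real^'n^'n"
  assumes "M ** N = mat 1"
  shows "matrix_inv M = N"
proof -
  have "invertible M"
    using assms matrix_left_right_inverse by (auto simp: invertible_def)
  then show ?thesis
    by (metis assms matrix_inv_left matrix_mul_assoc matrix_mul_lid matrix_mul_rid)
qed

lemma matrix_inv_Diag:
  assumes "\<And>i. v $ i \<noteq> 0"
  shows "Diag v ** Diag (\<chi> i. inverse (v $ i)) = mat 1"
    and "matrix_inv (Diag v) = Diag (\<chi> i. inverse (v $ i))"
proof -
  show "Diag v ** Diag (\<chi> i. inverse (v $ i)) = mat 1"
    using assms by (simp add: vec_eq_iff mat_def)
  then show "matrix_inv (Diag v) = Diag (\<chi> i. inverse (v $ i))"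
    by (rule matrix_inv_eqI)
qed

lemma pos_def_invertible:
  assumes "pos_def M"
  shows "invertible M"
proof -
  have "x = 0" if "M *v x = 0" for x
    using assms that unfolding pos_def_def by force
  then show ?thesis
    using matrix_left_invertible_ker[of M] matrix_left_right_inverse[of M]
    by (auto simp: invertible_def)
qed

lemma pos_def_matrix_inv:
  fixes A :: "real^'n^'n"
  assumes "pos_def A"
  shows "pos_def (matrix_inv A)"
proof -
  let ?C = "matrix_inv A"
  have A: "transpose A = A" and pos: "\<And>x. x \<noteq> 0 \<Longrightarrow> x \<bullet> (A *v x) > 0"
    using assms by (auto simp: pos_def_def)
  have inv: "A ** ?C = mat 1" "?C ** A = mat 1"
    using pos_def_invertible[OF assms] by (auto intro: matrix_inv_right matrix_inv_left)
  have "A ** transpose ?C = mat 1"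
    by (metis A inv(2) matrix_transpose_mul transpose_mat)
  then have sym: "transpose ?C = ?C"
    using matrix_inv_eqI by metis
  have "x \<bullet> (?C *v x) > 0" if "x \<noteq> 0" for x
  proof -
    let ?y = "?C *v x"
    have x: "A *v ?y = x"
      by (simp add: matrix_vector_mul_assoc inv)
    then have "?y \<noteq> 0"
      using that by force
    then have "?y \<bullet> (A *v ?y) > 0"
      by (rule pos)
    then show ?thesis
      by (simp add: x inner_commute)
  qed
  with sym show ?thesis
    by (simp add: pos_def_def)
qed

lemma transpose_component: "transpose M = M \<Longrightarrow> M $ i $ j = M $ j $ i"
  by (metis transpose_def vec_lambda_beta)

section \<open>The Schur product theorem\<close>

text \<open>
  Symmetric Gaussian elimination. If \<open>c\<close> is the row of \<open>C\<close> at a pivot index \<open>p\<close>, with pivot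
  \<open>a = C $ p $ p\<close>, then subtracting the rank-one matrix with entries \<open>c $ j * c $ k / a\<close>
  clears row and column \<open>p\<close> and leaves a matrix that is positive definite on the remaining
  coordinates. Relativising definiteness to a set \<open>S\<close> of indices allows induction on \<open>S\<close>.
\<close>
lemma gram_decomposition:
  fixes C :: "real^'n^'n"
  assumes "transpose C = C"
    and "\<And>i j. i \<notin> S \<Longrightarrow> C $ i $ j = 0"
    and "\<And>x. x \<noteq> 0 \<Longrightarrow> (\<And>i. i \<notin> S \<Longrightarrow> x $ i = 0) \<Longrightarrow> x \<bullet> (C *v x) > 0"
  obtains r :: "'n \<Rightarrow> real^'n"
    where "\<And>j k. C $ j $ k = (\<Sum>m\<in>S. r m $ j * r m $ k)"
proof -
  have "finite S" by simp
  then have "\<exists>r :: 'n \<Rightarrow> real^'n. \<forall>j k. C $ j $ k = (\<Sum>m\<in>S. r m $ j * r m $ k)"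
    using assms
  proof (induction S arbitrary: C rule: finite_induct)
    case empty
    then show ?case by simp
  next
    case (insert p S)
    note sym = insert.prems(1) and supp = insert.prems(2) and pos = insert.prems(3)
    have symc: "C $ i $ j = C $ j $ i" for i j
      by (rule transpose_component[OF sym])
    define a where "a = C $ p $ p"
    define c where "c = C $ p"
    have row: "axis p 1 \<bullet> (C *v x) = c \<bullet> x" for x
      by (simp add: inner_axis' matrix_vector_mul_component c_def)
    have col: "x \<bullet> (C *v axis p 1) = c \<bullet> x" for x
      using row[of x] by (metis sym dot_lmul_matrix inner_commute transpose_matrix_vector)
    have "a = axis p 1 \<bullet> (C *v axis p 1)"
      by (simp add: row inner_axis a_def c_def)
    moreover have "\<dots> > 0"
      by (rule pos) (auto simp: axis_def vec_eq_iff)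
    ultimately have a: "a > 0" by simp
    define C' where "C' = (\<chi> j k. C $ j $ k - c $ j * c $ k / a)"
    have sym': "transpose C' = C'"
      by (simp add: vec_eq_iff transpose_def C'_def symc mult.commute)
    have supp': "C' $ i $ j = 0" if "i \<notin> S" for i j
    proof (cases "i = p")
      case True
      with a show ?thesis by (simp add: C'_def c_def a_def)
    next
      case False
      then have "i \<notin> insert p S" using that by simp
      then have "C $ i $ j = 0" "C $ p $ i = 0"
        using supp symc by metis+
      then show ?thesis by (simp add: C'_def c_def)
    qed
    \<comment> \<open>Completing the square: the new form at \<open>x\<close> is the old one at \<open>y\<close>, the vector that
      minimises the old form along the line through \<open>x\<close> in the direction of the pivot axis.\<close>
    have pos': "x \<bullet> (C' *v x) > 0" if "x \<noteq> 0" and x: "\<And>i. i \<notin> S \<Longrightarrow> x $ i = 0" for x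
    proof -
      define t where "t = (c \<bullet> x) / a"
      define y where "y = x - t *\<^sub>R axis p 1"
      obtain i where i: "x $ i \<noteq> 0" using \<open>x \<noteq> 0\<close> by (auto simp: vec_eq_iff)
      then have "i \<noteq> p" using x insert.hyps by metis
      then have "y $ i \<noteq> 0" using i by (simp add: y_def axis_def)
      then have "y \<noteq> 0" by auto
      then have "0 < y \<bullet> (C *v y)"
        by (rule pos) (auto simp: y_def x axis_def)
      also have "y \<bullet> (C *v y) = x \<bullet> (C *v x) - 2 * t * (c \<bullet> x) + t\<^sup>2 * a"
        using row[of "axis p 1"]
        by (simp add: y_def matrix_vector_mult_diff_distrib matrix_vector_mult_scaleR
            inner_diff_left inner_diff_right row col inner_axis c_def a_def power2_eq_square
            algebra_simps)
      also have "\<dots> = x \<bullet> (C *v x) - (c \<bullet> x) * (c \<bullet> x) / a"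
        using a by (simp add: t_def power2_eq_square field_simps)
      also have "(c \<bullet> x) * (c \<bullet> x) / a =
          (\<Sum>i\<in>UNIV. \<Sum>j\<in>UNIV. x $ i * (c $ i * c $ j / a) * x $ j)"
        unfolding inner_vec_def sum_product sum_divide_distrib
        by (intro sum.cong refl) (simp add: field_simps)
      also have "x \<bullet> (C *v x) - \<dots> = x \<bullet> (C' *v x)"
        by (simp add: quadratic_form_sum C'_def sum_subtractf algebra_simps)
      finally show ?thesis .
    qed
    obtain r where r: "\<And>j k. C' $ j $ k = (\<Sum>m\<in>S. r m $ j * r m $ k)"
      using insert.IH[OF sym' supp' pos'] by blast
    define r' where "r' = r(p := (1 / sqrt a) *\<^sub>R c)"
    have "C $ j $ k = (\<Sum>m\<in>insert p S. r' m $ j * r' m $ k)" for j k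
    proof -
      have "(\<Sum>m\<in>S. r' m $ j * r' m $ k) = (\<Sum>m\<in>S. r m $ j * r m $ k)"
        using insert.hyps by (intro sum.cong) (auto simp: r'_def)
      moreover have "r' p $ j * r' p $ k = c $ j * c $ k / a"
        using a by (simp add: r'_def field_simps)
      ultimately show ?thesis
        using insert.hyps r[of j k] by (simp add: C'_def)
    qed
    then show ?case by blast
  qed
  then show thesis using that by blast
qed

text \<open>
  Expanding \<open>P\<close> as a sum of rank-one matrices turns the quadratic form of \<open>C \<circ>\<^sub>H P\<close> into a
  sum of values of the form of \<open>C\<close> at the vectors \<open>x * r m\<close>. Not all of these vectors vanish
  when \<open>x\<close> is nonzero, since the diagonal of \<open>P\<close> is positive.
\<close>
lemma schur_product_pos_def:
  fixes C P :: "real^'n^'n"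
  assumes "pos_def C" "pos_def P"
  shows "pos_def (C \<circ>\<^sub>H P)"
proof -
  have symC: "transpose C = C" and posC: "\<And>x. x \<noteq> 0 \<Longrightarrow> x \<bullet> (C *v x) > 0"
    and symP: "transpose P = P" and posP: "\<And>x. x \<noteq> 0 \<Longrightarrow> x \<bullet> (P *v x) > 0"
    using assms by (auto simp: pos_def_def)
  obtain r :: "'n \<Rightarrow> real^'n" where r: "\<And>j k. P $ j $ k = (\<Sum>m\<in>UNIV. r m $ j * r m $ k)"
    by (rule gram_decomposition[of P UNIV]) (use symP posP in auto)
  have "transpose (C \<circ>\<^sub>H P) = C \<circ>\<^sub>H P"
    by (simp add: vec_eq_iff transpose_def transpose_component[OF symC] transpose_component[OF symP])
  moreover have "x \<bullet> ((C \<circ>\<^sub>H P) *v x) > 0" if "x \<noteq> 0" for x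
  proof -
    have "x \<bullet> ((C \<circ>\<^sub>H P) *v x)
        = (\<Sum>i\<in>UNIV. \<Sum>j\<in>UNIV. \<Sum>m\<in>UNIV. (x * r m) $ i * C $ i $ j * (x * r m) $ j)"
      by (simp add: quadratic_form_sum r sum_distrib_left sum_distrib_right algebra_simps)
    also have "\<dots> = (\<Sum>i\<in>UNIV. \<Sum>m\<in>UNIV. \<Sum>j\<in>UNIV. (x * r m) $ i * C $ i $ j * (x * r m) $ j)"
      by (intro sum.cong refl sum.swap)
    also have "\<dots> = (\<Sum>m\<in>UNIV. \<Sum>i\<in>UNIV. \<Sum>j\<in>UNIV. (x * r m) $ i * C $ i $ j * (x * r m) $ j)"
      by (rule sum.swap)
    also have "\<dots> = (\<Sum>m\<in>UNIV. (x * r m) \<bullet> (C *v (x * r m)))"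
      by (simp add: quadratic_form_sum)
    also have "\<dots> > 0"
    proof -
      have nonneg: "(x * r m) \<bullet> (C *v (x * r m)) \<ge> 0" for m
        using posC[of "x * r m"] by (cases "x * r m = 0") auto
      obtain i where i: "x $ i \<noteq> 0" using \<open>x \<noteq> 0\<close> by (auto simp: vec_eq_iff)
      have "0 < axis i 1 \<bullet> (P *v axis i 1)"
        by (rule posP) (auto simp: axis_def vec_eq_iff)
      then have "P $ i $ i \<noteq> 0"
        by (simp add: inner_axis inner_axis' matrix_vector_mul_component)
      then obtain m where "r m $ i \<noteq> 0"
        using r[of i i] by (metis (no_types, lifting) mult_eq_0_iff sum.neutral)
      then have "(x * r m) $ i \<noteq> 0" using i by simp
      then have "x * r m \<noteq> 0" by (metis zero_index)
      then show ?thesis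
        using posC nonneg by (intro sum_pos2[of _ m]) auto
    qed
    finally show ?thesis .
  qed
  ultimately show ?thesis by (simp add: pos_def_def)
qed

section \<open>The principal square root of a diagonal matrix\<close>

lemma matrix_add_rdistrib: "(A + B) ** C = A ** C + B ** C" for A B C :: "real^'n^'n"
  by (simp add: matrix_matrix_mult_def vec_eq_iff distrib_right sum.distrib)

lemma matrix_diff_ldistrib: "A ** (B - C) = A ** B - A ** C" for A B C :: "real^'n^'n"
  by (simp add: matrix_matrix_mult_def vec_eq_iff right_diff_distrib sum_subtractf)

text \<open>
  The content is uniqueness. A square root \<open>S\<close> of \<open>Diag v\<close> commutes with \<open>Diag v\<close>, so it can
  link only coordinates on which \<open>v\<close> agrees; hence it commutes with the entrywise square root
  \<open>T\<close> as well. Then \<open>(T + S) (S - T) = 0\<close>, and \<open>T + S\<close> is invertible because it is positive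
  definite.
\<close>
lemma mat_sqrt_Diag:
  fixes v :: "real^'n"
  assumes "v \<in> pos_vecs"
  shows "mat_sqrt (Diag v) = Diag (\<chi> i. sqrt (v $ i))"
proof -
  let ?T = "Diag (\<chi> i. sqrt (v $ i))"
  have v: "v $ i > 0" for i using assms by (simp add: pos_vecs_def)
  have Tform: "x \<bullet> (?T *v x) = (\<Sum>i\<in>UNIV. sqrt (v $ i) * (x $ i)\<^sup>2)" for x
    by (simp add: quadratic_form_sum if_distrib if_distribR power2_eq_square algebra_simps cong: if_cong)
  have Tpos: "x \<bullet> (?T *v x) > 0" if nz: "x \<noteq> 0" for x
  proof -
    obtain i where "x $ i \<noteq> 0" using nz by (auto simp: vec_eq_iff)
    then show ?thesis
      unfolding Tform using v by (intro sum_pos2[of _ i]) (auto simp: less_imp_le)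
  qed
  have TT: "?T ** ?T = Diag v"
    using v by (simp add: vec_eq_iff less_imp_le)
  have Tsym: "transpose ?T = ?T" by (auto simp: vec_eq_iff transpose_def)
  have Tpsd: "pos_semidef ?T"
    unfolding pos_semidef_def using Tsym Tpos by (metis inner_zero_left less_imp_le order_refl)
  have uniq: "S = ?T" if S: "pos_semidef S" and SS: "S ** S = Diag v" for S
  proof -
    have "S ** Diag v = Diag v ** S"
      by (metis SS matrix_mul_assoc)
    then have c: "S $ i $ j * v $ j = v $ i * S $ i $ j" for i j
      by (metis mult_Diag_component Diag_mult_component)
    have "S $ i $ j * sqrt (v $ j) = sqrt (v $ i) * S $ i $ j" for i j
      using c[of i j] by (cases "S $ i $ j = 0") auto
    then have comm: "S ** ?T = ?T ** S" by (simp add: vec_eq_iff)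
    have "pos_def (?T + S)"
      using S Tsym Tpos unfolding pos_def_def pos_semidef_def
      by (auto simp: vec_eq_iff transpose_def matrix_vector_mult_add_rdistrib inner_add_right
          add_pos_nonneg)
    then obtain N where N: "N ** (?T + S) = mat 1"
      using pos_def_invertible unfolding invertible_def by blast
    have "(?T + S) ** (S - ?T) = 0"
      by (simp add: matrix_add_rdistrib matrix_diff_ldistrib TT SS comm)
    then have "N ** ((?T + S) ** (S - ?T)) = 0"
      by (simp add: matrix_matrix_mult_def vec_eq_iff)
    then have "S - ?T = 0"
      by (simp add: matrix_mul_assoc N)
    then show ?thesis by simp
  qed
  show ?thesis
    unfolding mat_sqrt_def by (rule the_equality) (use Tpsd TT uniq in blast)+
qed

section \<open>Existence and uniqueness of the scaling vector\<close>

text \<open>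
  A maximiser of the product of the entries under the constraint \<open>v \<bullet> (B *v v) \<le> n\<close>, \<open>v \<ge> 0\<close>,
  has positive entries, because the maximum is positive. Rescaling positive vectors into the
  constraint set removes the constraint: \<open>v\<close> maximises the sum of the \<open>ln (w $ i)\<close> minus
  \<open>n / 2 * ln (w \<bullet> (B *v w))\<close> over all positive \<open>w\<close>. The partial derivatives of this
  function at \<open>v\<close> are \<open>1 / v $ i - (B *v v) $ i\<close>, and they vanish.
\<close>
lemma optimal_scaling_exists:
  fixes B :: "real^'n^'n"
  assumes B: "pos_def B" and nonneg: "\<And>i j. B $ i $ j \<ge> 0"
  obtains v where "v \<in> pos_vecs" "\<And>i. (B *v v) $ i = 1 / v $ i"
proof -
  define n where "n = real CARD('n)"
  have n: "n > 0" by (simp add: n_def)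
  define Q where "Q = (\<lambda>v. v \<bullet> (B *v v))"
  have Qpos: "Q x > 0" if "x \<noteq> 0" for x
    using B that by (simp add: pos_def_def Q_def)
  have Qscale: "Q (c *\<^sub>R x) = c\<^sup>2 * Q x" for c x
    by (simp add: Q_def matrix_vector_mult_scaleR power2_eq_square)
  have sym: "x \<bullet> (B *v y) = y \<bullet> (B *v x)" for x y
    using B unfolding pos_def_def
    by (metis dot_lmul_matrix inner_commute transpose_matrix_vector)
  have diag_pos: "B $ i $ i > 0" for i
    using Qpos[of "axis i 1"]
    by (simp add: Q_def inner_axis inner_axis' matrix_vector_mul_component axis_eq_0_iff)
  define K where "K = {v. (\<forall>i. 0 \<le> v $ i) \<and> Q v \<le> n}"
  have contQ: "continuous_on UNIV Q"
    unfolding Q_def by (intro continuous_intros linear_continuous_on)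
  have "closed K"
  proof -
    have "K = (\<Inter>i. {v. 0 \<le> v $ i}) \<inter> {v. Q v \<le> n}" by (auto simp: K_def)
    moreover have "closed {v. Q v \<le> n}"
      using contQ by (intro closed_Collect_le continuous_intros) auto
    moreover have "closed {v :: real^'n. 0 \<le> v $ i}" for i
      by (intro closed_Collect_le continuous_intros)
    ultimately show ?thesis by (auto intro!: closed_Int closed_INT)
  qed
  moreover have "bounded K"
  proof -
    \<comment> \<open>As all terms of the form are nonnegative on \<open>K\<close>, each diagonal one is at most \<open>n\<close>.\<close>
    have "\<bar>v $ i\<bar> \<le> sqrt (n / B $ i $ i)" if "v \<in> K" for v i
    proof -
      have v: "0 \<le> v $ k" for k using that by (simp add: K_def)
      have "v $ i * B $ i $ i * v $ i \<le> (\<Sum>j\<in>UNIV. v $ i * B $ i $ j * v $ j)"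
        using v nonneg by (intro member_le_sum) auto
      also have "\<dots> \<le> Q v"
        unfolding Q_def quadratic_form_sum
        using v nonneg by (intro member_le_sum sum_nonneg) auto
      also have "\<dots> \<le> n" using that by (simp add: K_def)
      finally have "(v $ i)\<^sup>2 \<le> n / B $ i $ i"
        using diag_pos[of i] by (simp add: field_simps power2_eq_square)
      then show ?thesis using real_le_rsqrt v by auto
    qed
    then have "norm v \<le> (\<Sum>i\<in>UNIV. sqrt (n / B $ i $ i))" if "v \<in> K" for v
      using that by (intro order_trans[OF norm_le_l1_cart] sum_mono)
    then show ?thesis
      unfolding bounded_iff by blast
  qed
  ultimately have "compact K" by (simp add: compact_eq_bounded_closed)
  have in_K: "sqrt (n / Q w) *\<^sub>R w \<in> K" if "w \<in> pos_vecs" for w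
  proof -
    have "w \<noteq> 0" using that by (auto simp: pos_vecs_def)
    then show ?thesis
      using Qpos[of w] n that by (auto simp: K_def Qscale pos_vecs_def less_imp_le)
  qed
  have one: "(1 :: real^'n) \<in> pos_vecs" by (simp add: pos_vecs_def)
  have "continuous_on K (\<lambda>v. \<Prod>i\<in>UNIV. v $ i)" by (intro continuous_intros)
  then obtain v where "v \<in> K" and vmax: "\<And>w. w \<in> K \<Longrightarrow> (\<Prod>i\<in>UNIV. w $ i) \<le> (\<Prod>i\<in>UNIV. v $ i)"
    using continuous_attains_sup[OF \<open>compact K\<close>] in_K[OF one] by blast
  have hmax: "(sqrt (n / Q w)) ^ CARD('n) * (\<Prod>i\<in>UNIV. w $ i) \<le> (\<Prod>i\<in>UNIV. v $ i)"
    if "w \<in> pos_vecs" for w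
    using vmax[OF in_K[OF that]] by (simp add: prod.distrib)
  have pos_nz: "w \<noteq> 0" if "w \<in> pos_vecs" for w :: "real^'n"
    using that by (auto simp: pos_vecs_def)
  have "0 < sqrt (n / Q 1) ^ CARD('n)"
    using n Qpos[OF pos_nz[OF one]] by simp
  also have "\<dots> \<le> (\<Prod>i\<in>UNIV. v $ i)"
    using hmax[OF one] by simp
  finally have "0 < (\<Prod>i\<in>UNIV. v $ i)" .
  then have "v $ i \<noteq> 0" for i
    by (metis UNIV_I finite less_irrefl prod_zero)
  then have v: "v $ i > 0" for i
    using \<open>v \<in> K\<close> by (simp add: K_def less_le)
  then have vp: "v \<in> pos_vecs" by (simp add: pos_vecs_def)
  have lnmax: "n / 2 * (ln n - ln (Q w)) + (\<Sum>i\<in>UNIV. ln (w $ i)) \<le> (\<Sum>i\<in>UNIV. ln (v $ i))"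
    if w: "w \<in> pos_vecs" for w
  proof -
    have q: "Q w > 0" by (rule Qpos[OF pos_nz[OF w]])
    have wi: "w $ i > 0" for i using w by (simp add: pos_vecs_def)
    have "ln ((sqrt (n / Q w)) ^ CARD('n) * (\<Prod>i\<in>UNIV. w $ i)) \<le> ln (\<Prod>i\<in>UNIV. v $ i)"
      using hmax[OF w] q n wi by (intro ln_mono mult_pos_pos prod_pos) auto
    moreover have "ln ((sqrt (n / Q w)) ^ CARD('n) * (\<Prod>i\<in>UNIV. w $ i))
        = n / 2 * (ln n - ln (Q w)) + (\<Sum>i\<in>UNIV. ln (w $ i))"
      using q n wi by (simp add: ln_mult prod_pos ln_realpow ln_sqrt ln_div ln_prod n_def
         less_imp_neq[THEN not_sym])
    moreover have "ln (\<Prod>i\<in>UNIV. v $ i) = (\<Sum>i\<in>UNIV. ln (v $ i))"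
      using v by (simp add: ln_prod less_imp_neq[THEN not_sym])
    ultimately show ?thesis by simp
  qed
  have Qv: "Q v = n"
  proof (rule antisym)
    show "Q v \<le> n" using \<open>v \<in> K\<close> by (simp add: K_def)
    show "n \<le> Q v"
      using lnmax[OF vp] n Qpos[OF pos_nz[OF vp]] by (simp add: mult_le_0_iff)
  qed
  have "(B *v v) $ i = 1 / v $ i" for i
  proof -
    define s where "s = (B *v v) $ i"
    \<comment> \<open>The objective along \<open>v + t *\<^sub>R axis i 1\<close>, up to terms independent of \<open>t\<close>; the
      argument of the second logarithm is the quadratic form at that vector.\<close>
    define f where "f = (\<lambda>t. ln (v $ i + t) - n / 2 * ln (n + 2 * t * s + t\<^sup>2 * B $ i $ i))"
    have f_der: "(f has_real_derivative (1 / v $ i - s)) (at 0)"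
      unfolding f_def using v[of i] n
      by (auto intro!: derivative_eq_intros simp: field_simps)
    have "f t \<le> f 0" if t: "\<bar>0 - t\<bar> < v $ i" for t
    proof -
      let ?w = "v + t *\<^sub>R axis i 1"
      have wp: "?w \<in> pos_vecs" using v t by (auto simp: pos_vecs_def axis_def)
      have "axis i 1 \<bullet> (B *v axis i 1) = B $ i $ i"
        by (simp add: inner_axis inner_axis' matrix_vector_mul_component)
      then have Qw: "Q ?w = n + 2 * t * s + t\<^sup>2 * B $ i $ i"
        using Qv sym[of v "axis i 1"]
        by (simp add: Q_def s_def matrix_vector_right_distrib matrix_vector_mult_scaleR
            inner_add_left inner_add_right inner_axis' power2_eq_square algebra_simps)
      have "(\<Sum>k\<in>UNIV. ln (?w $ k)) = ln (v $ i + t) + (\<Sum>k\<in>UNIV - {i}. ln (v $ k))"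
        by (subst sum.remove[of _ i]) (auto simp: axis_def intro!: sum.cong)
      moreover have "(\<Sum>k\<in>UNIV. ln (v $ k)) = ln (v $ i) + (\<Sum>k\<in>UNIV - {i}. ln (v $ k))"
        by (subst sum.remove[of _ i]) auto
      ultimately show ?thesis
        using lnmax[OF wp] by (simp add: Qw f_def algebra_simps)
    qed
    then have "1 / v $ i - s = 0"
      using DERIV_local_max[OF f_der v[of i]] by blast
    then show ?thesis by (simp add: s_def)
  qed
  then show thesis using that vp by blast
qed

lemma optimal_scaling_unique:
  fixes B :: "real^'n^'n"
  assumes "pos_def B" "v \<in> pos_vecs" "w \<in> pos_vecs"
    and "\<And>i. (B *v v) $ i = 1 / v $ i" "\<And>i. (B *v w) $ i = 1 / w $ i"
  shows "v = w"
proof (rule ccontr)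
  assume "v \<noteq> w"
  then have "0 < (v - w) \<bullet> (B *v (v - w))"
    using assms(1) by (simp add: pos_def_def)
  also have "\<dots> = (\<Sum>i\<in>UNIV. (v $ i - w $ i) * (1 / v $ i - 1 / w $ i))"
    by (simp add: inner_vec_def matrix_vector_mult_diff_distrib assms)
  also have "\<dots> \<le> 0"
  proof (rule sum_nonpos)
    fix i
    have p: "v $ i > 0" "w $ i > 0" using assms by (auto simp: pos_vecs_def)
    have "(v $ i - w $ i) * (1 / v $ i - 1 / w $ i) = - ((v $ i - w $ i)\<^sup>2 / (v $ i * w $ i))"
      using p by (simp add: field_simps power2_eq_square)
    then show "(v $ i - w $ i) * (1 / v $ i - 1 / w $ i) \<le> 0"
      using p by simp
  qed
  finally show False by simp
qed

section \<open>Optimality of the scaling vector\<close>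

text \<open>
  The weighted inequality of arithmetic and geometric means for the products \<open>s i * s j\<close> with
  weights \<open>M i j / n\<close>, where \<open>M\<close> has row and column sums 1. Their weighted geometric mean is
  the left-hand side \<open>G\<close>. The proof sums the tangent inequality \<open>1 + ln (y / G) \<le> y / G\<close> over
  \<open>y = s i * s j\<close>; the logarithmic terms cancel by the choice of \<open>G\<close>.
\<close>
lemma scaling_inequality:
  fixes B :: "real^'n^'n"
  assumes nonneg: "\<And>i j. B $ i $ j \<ge> 0" and sym: "transpose B = B"
    and "v \<in> pos_vecs" "w \<in> pos_vecs"
    and eq: "\<And>i. (B *v v) $ i = 1 / v $ i"
  shows "root CARD('n) (((\<Prod>i\<in>UNIV. w $ i) / (\<Prod>i\<in>UNIV. v $ i))\<^sup>2)
      \<le> (w \<bullet> (B *v w)) / real CARD('n)"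
proof -
  define n where "n = real CARD('n)"
  have n: "n > 0" by (simp add: n_def)
  have v: "v $ i > 0" and w: "w $ i > 0" for i using assms by (auto simp: pos_vecs_def)
  define s where "s = (\<lambda>i. w $ i / v $ i)"
  have s: "s i > 0" for i using v w by (simp add: s_def)
  define M where "M = (\<lambda>i j. v $ i * B $ i $ j * v $ j)"
  have M: "M i j \<ge> 0" for i j using v nonneg by (simp add: M_def less_imp_le)
  have row: "(\<Sum>j\<in>UNIV. M i j) = 1" for i
  proof -
    have "(\<Sum>j\<in>UNIV. M i j) = v $ i * (B *v v) $ i"
      by (simp add: M_def matrix_vector_mult_def sum_distrib_left mult.assoc)
    then show ?thesis using v[of i] eq by simp
  qed
  have Msym: "M i j = M j i" for i j
    using transpose_component[OF sym, of i j] by (simp add: M_def)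
  define L where "L = (\<Sum>i\<in>UNIV. ln (s i))"
  define G where "G = exp (2 / n * L)"
  have "root CARD('n) (((\<Prod>i\<in>UNIV. w $ i) / (\<Prod>i\<in>UNIV. v $ i))\<^sup>2) = G"
  proof (rule real_root_pos_unique)
    have "G ^ CARD('n) = exp (2 * L)"
      using n by (simp add: G_def n_def flip: exp_of_nat_mult)
    also have "\<dots> = (exp L)\<^sup>2" by (simp add: exp_double)
    also have "exp L = (\<Prod>i\<in>UNIV. s i)"
      using s by (simp add: L_def exp_sum)
    finally show "G ^ CARD('n) = ((\<Prod>i\<in>UNIV. w $ i) / (\<Prod>i\<in>UNIV. v $ i))\<^sup>2"
      by (simp add: s_def prod_dividef)
  qed (auto simp: G_def)
  also have "G * n \<le> w \<bullet> (B *v w)"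
  proof -
    have "G * n = (\<Sum>i\<in>UNIV. \<Sum>j\<in>UNIV. M i j * (G * (1 + ln (s i) + ln (s j) - 2 / n * L)))"
    proof -
      have si: "(\<Sum>i\<in>UNIV. \<Sum>j\<in>UNIV. M i j * ln (s i)) = L"
        by (simp add: L_def row flip: sum_distrib_right)
      have sj: "(\<Sum>i\<in>UNIV. \<Sum>j\<in>UNIV. M i j * ln (s j)) = L"
        by (subst sum.swap) (simp add: L_def row Msym flip: sum_distrib_right)
      have const: "(\<Sum>i\<in>UNIV. \<Sum>j\<in>UNIV. M i j * c) = n * c" for c
        by (simp add: row n_def flip: sum_distrib_right)
      have "(\<Sum>i\<in>UNIV. \<Sum>j\<in>UNIV. M i j * (G * (1 + ln (s i) + ln (s j) - 2 / n * L)))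
          = n * (G * (1 - 2 / n * L))
           + G * (\<Sum>i\<in>UNIV. \<Sum>j\<in>UNIV. M i j * ln (s i))
           + G * (\<Sum>i\<in>UNIV. \<Sum>j\<in>UNIV. M i j * ln (s j))"
        unfolding const[symmetric] sum_distrib_left sum.distrib[symmetric]
        by (intro sum.cong refl) (simp add: algebra_simps)
      then show ?thesis using n by (simp add: si sj field_simps)
    qed
    also have "\<dots> \<le> (\<Sum>i\<in>UNIV. \<Sum>j\<in>UNIV. M i j * (s i * s j))"
    proof (intro sum_mono mult_left_mono M)
      fix i j
      have "1 + (ln (s i) + ln (s j) - 2 / n * L) \<le> exp (ln (s i) + ln (s j) - 2 / n * L)"
        by (rule exp_ge_add_one_self)
      also have "\<dots> = s i * s j / G"
        using s by (simp add: exp_diff exp_add G_def)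
      finally show "G * (1 + ln (s i) + ln (s j) - 2 / n * L) \<le> s i * s j"
        by (simp add: G_def field_simps)
    qed
    also have "\<dots> = w \<bullet> (B *v w)"
      unfolding quadratic_form_sum M_def s_def
      using v by (intro sum.cong refl) (simp add: field_simps less_imp_neq[THEN not_sym])
    finally show ?thesis .
  qed
  then have "G \<le> (w \<bullet> (B *v w)) / n" using n by (simp add: field_simps)
  finally show ?thesis by (simp add: n_def)
qed

lemma omega_scaled_square:
  fixes C :: "real^'n^'n"
  assumes "transpose C = C"
  shows "omega (Diag e ** C ** Diag e ** Diag e ** C ** Diag e) =
    ((e * e) \<bullet> ((C \<circ>\<^sub>H C) *v (e * e)) / real CARD('n))
      / root CARD('n) ((\<Prod>i\<in>UNIV. (e * e) $ i)\<^sup>2 * (det C)\<^sup>2)"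
proof -
  let ?X = "Diag e ** C ** Diag e"
  have X: "Diag e ** C ** Diag e ** Diag e ** C ** Diag e = ?X ** ?X"
    by (simp add: matrix_mul_assoc)
  have "trace (?X ** ?X) = (\<Sum>i\<in>UNIV. \<Sum>j\<in>UNIV. ?X $ i $ j * ?X $ j $ i)"
    by (simp add: trace_def matrix_matrix_mult_def)
  also have "\<dots> = (e * e) \<bullet> ((C \<circ>\<^sub>H C) *v (e * e))"
    unfolding quadratic_form_sum
    by (intro sum.cong refl) (simp add: transpose_component[OF assms] algebra_simps)
  finally have tr: "trace (?X ** ?X) = (e * e) \<bullet> ((C \<circ>\<^sub>H C) *v (e * e))" .
  have "det (Diag e) = (\<Prod>i\<in>UNIV. e $ i)"
    by (subst det_diagonal) auto
  then have "det (?X ** ?X) = (\<Prod>i\<in>UNIV. (e * e) $ i)\<^sup>2 * (det C)\<^sup>2"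
    by (simp add: det_mul prod.distrib power2_eq_square)
  with tr show ?thesis unfolding X omega_def by simp
qed

text \<open>
  At \<open>d\<close> the quadratic form equals \<open>n\<close>, so the numerator of omega is 1 and only the
  determinant remains; passing from \<open>d\<close> to \<open>e\<close> multiplies the root of the determinant by the
  very factor by which \<open>scaling_inequality\<close> bounds the numerator from below.
\<close>
lemma omega_minimal:
  fixes C :: "real^'n^'n"
  assumes C: "pos_def C" and d: "d \<in> pos_vecs" and e: "e \<in> pos_vecs"
    and eq: "\<And>i. ((C \<circ>\<^sub>H C) *v (d * d)) $ i = 1 / (d * d) $ i"
  shows "omega (Diag d ** C ** Diag d ** Diag d ** C ** Diag d)
    \<le> omega (Diag e ** C ** Diag e ** Diag e ** C ** Diag e)"
proof -
  have sym: "transpose C = C" using C by (simp add: pos_def_def)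
  define v where "v = d * d"
  define w where "w = e * e"
  define Pv where "Pv = (\<Prod>i\<in>UNIV. v $ i)"
  define Pw where "Pw = (\<Prod>i\<in>UNIV. w $ i)"
  have v: "v \<in> pos_vecs" and w: "w \<in> pos_vecs"
    using d e by (auto simp: v_def w_def pos_vecs_def)
  have P: "Pv > 0" "Pw > 0" using v w by (auto simp: Pv_def Pw_def pos_vecs_def prod_pos)
  have detC: "det C \<noteq> 0"
    using pos_def_invertible[OF C] by (simp add: invertible_det_nz)
  have symB: "transpose (C \<circ>\<^sub>H C) = C \<circ>\<^sub>H C"
    by (simp add: vec_eq_iff transpose_def transpose_component[OF sym])
  have eqv: "((C \<circ>\<^sub>H C) *v v) $ i = 1 / v $ i" for i
    using eq by (simp add: v_def)
  have Qv: "v \<bullet> ((C \<circ>\<^sub>H C) *v v) = real CARD('n)"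
    using v by (simp add: inner_vec_def eqv pos_vecs_def less_imp_neq[THEN not_sym])
  define R where "R = root CARD('n) (Pv\<^sup>2 * (det C)\<^sup>2)"
  define G where "G = root CARD('n) ((Pw / Pv)\<^sup>2)"
  have RG: "R > 0" "G > 0" using P detC by (auto simp: R_def G_def)
  have "G \<le> w \<bullet> ((C \<circ>\<^sub>H C) *v w) / real CARD('n)"
    unfolding G_def Pv_def Pw_def
    by (rule scaling_inequality) (use symB v w eqv in auto)
  moreover have "root CARD('n) (Pw\<^sup>2 * (det C)\<^sup>2) = G * R"
    using P by (simp add: G_def R_def power_divide flip: real_root_mult)
  ultimately have "1 / R \<le> (w \<bullet> ((C \<circ>\<^sub>H C) *v w) / real CARD('n)) / root CARD('n) (Pw\<^sup>2 * (det C)\<^sup>2)"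
    using RG by (simp add: field_simps)
  then show ?thesis
    unfolding omega_scaled_square[OF sym] v_def[symmetric] w_def[symmetric]
    by (simp add: Qv R_def Pv_def Pw_def)
qed

section \<open>The scaled linear system\<close>

lemma inv_scaled_Diag:
  fixes A :: "real^'n^'n"
  assumes "invertible A" "\<And>i. e $ i \<noteq> 0"
  shows "matrix_inv (scaled (Diag e) A) = Diag e ** matrix_inv A ** Diag e"
proof (rule matrix_inv_eqI)
  let ?E = "Diag e" and ?F = "matrix_inv (Diag e)"
  have EF: "?E ** ?F = mat 1" "?F ** ?E = mat 1"
    using matrix_inv_Diag[of e] assms(2) by (auto simp: matrix_left_right_inverse)
  have "scaled ?E A ** (?E ** matrix_inv A ** ?E)
      = ?F ** (A ** ((?F ** ?E) ** matrix_inv A)) ** ?E"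
    by (simp add: scaled_def matrix_mul_assoc)
  also have "\<dots> = mat 1"
    using assms(1) by (simp add: EF matrix_inv_right)
  finally show "scaled ?E A ** (?E ** matrix_inv A ** ?E) = mat 1" .
qed

lemma scaled_system_iff:
  fixes A :: "real^'n^'n"
  assumes "invertible D"
  shows "A *v x = b \<longleftrightarrow> scaled D A *v (D *v x) = matrix_inv D *v b"
proof -
  have inv: "D ** matrix_inv D = mat 1" "matrix_inv D ** D = mat 1"
    using assms by (auto simp: matrix_inv_right matrix_inv_left)
  have "scaled D A *v (D *v x) = matrix_inv D *v (A *v ((matrix_inv D ** D) *v x))"
    by (simp add: scaled_def matrix_vector_mul_assoc matrix_mul_assoc)
  then have "scaled D A *v (D *v x) = matrix_inv D *v (A *v x)"
    by (simp add: inv)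
  moreover have "D *v (matrix_inv D *v y) = y" for y
    by (simp add: matrix_vector_mul_assoc inv)
  ultimately show ?thesis by metis
qed

theorem theorem2p2:
  fixes A B :: "real^'n^'n"
  assumes "pos_def A"
    and "B = matrix_inv A \<circ>\<^sub>H matrix_inv A"
  shows
    "pos_def B \<and> (\<forall>i j. B $ i $ j \<ge> 0) \<and>
     (\<exists>!dbar. dbar \<in> pos_vecs \<and> B *v dbar = diag (matrix_inv (Diag dbar))) \<and>
     (\<forall>dbar Dbar D d.
        dbar \<in> pos_vecs \<longrightarrow>
        Dbar = Diag dbar \<longrightarrow>
        B *v dbar = diag (matrix_inv Dbar) \<longrightarrow>
        D = mat_sqrt Dbar \<longrightarrow>
        d = diag D \<longrightarrow>
          diag (matrix_inv Dbar) \<in> pos_vecs \<and>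
          (\<forall>i. (B *v dbar) $ i = 1 / dbar $ i) \<and>
          dbar \<bullet> (B *v dbar) = real CARD('n) \<and>
          D = Diag d \<and>
          is_arg_min
            (\<lambda>e. omega (Diag e ** matrix_inv A ** Diag e ** Diag e ** matrix_inv A ** Diag e))
            (\<lambda>e. e \<in> pos_vecs) d \<and>
          is_arg_min
            (\<lambda>e. omega (matrix_inv (scaled (Diag e) A) ** matrix_inv (scaled (Diag e) A)))
            (\<lambda>e. e \<in> pos_vecs) d \<and>
          (\<forall>x b. A *v x = b \<longleftrightarrow> scaled D A *v (D *v x) = matrix_inv D *v b))"
proof -
  define C where "C = matrix_inv A"
  have C: "pos_def C" unfolding C_def by (rule pos_def_matrix_inv[OF assms(1)])
  have BC: "B = C \<circ>\<^sub>H C" by (simp add: assms(2) C_def)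
  have B: "pos_def B" unfolding BC by (rule schur_product_pos_def[OF C C])
  have nonneg: "B $ i $ j \<ge> 0" for i j by (simp add: BC)
  have invA: "invertible A" by (rule pos_def_invertible[OF assms(1)])
  have diag_inv: "diag (matrix_inv (Diag v)) = (\<chi> i. 1 / v $ i)" if "v \<in> pos_vecs" for v
    using that by (subst matrix_inv_Diag(2)) (auto simp: vec_eq_iff pos_vecs_def inverse_eq_divide
        less_imp_neq[THEN not_sym])
  have eq_iff: "B *v v = diag (matrix_inv (Diag v)) \<longleftrightarrow> (\<forall>i. (B *v v) $ i = 1 / v $ i)"
    if "v \<in> pos_vecs" for v
    using that by (simp add: diag_inv vec_eq_iff del: diag_component)
  have ex1: "\<exists>!v. v \<in> pos_vecs \<and> B *v v = diag (matrix_inv (Diag v))"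
  proof -
    obtain v where v: "v \<in> pos_vecs" "\<And>i. (B *v v) $ i = 1 / v $ i"
      using optimal_scaling_exists[OF B nonneg] by blast
    then have "w = v" if "w \<in> pos_vecs \<and> B *v w = diag (matrix_inv (Diag w))" for w
      using that optimal_scaling_unique[OF B] eq_iff by metis
    with v show ?thesis using eq_iff by metis
  qed
  have main: "diag (matrix_inv V) \<in> pos_vecs \<and>
          (\<forall>i. (B *v v) $ i = 1 / v $ i) \<and>
          v \<bullet> (B *v v) = real CARD('n) \<and>
          D = Diag d \<and>
          is_arg_min
            (\<lambda>e. omega (Diag e ** C ** Diag e ** Diag e ** C ** Diag e))
            (\<lambda>e. e \<in> pos_vecs) d \<and>
          is_arg_min
            (\<lambda>e. omega (matrix_inv (scaled (Diag e) A) ** matrix_inv (scaled (Diag e) A)))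
            (\<lambda>e. e \<in> pos_vecs) d \<and>
          (\<forall>x b. A *v x = b \<longleftrightarrow> scaled D A *v (D *v x) = matrix_inv D *v b)"
    if v: "v \<in> pos_vecs" and V: "V = Diag v" and eq0: "B *v v = diag (matrix_inv V)"
      and D0: "D = mat_sqrt V" and d0: "d = diag D" for v V D d
  proof -
    have vi: "v $ i > 0" for i using v by (simp add: pos_vecs_def)
    have eq: "(B *v v) $ i = 1 / v $ i" for i using eq0 eq_iff[OF v] V by blast
    have D: "D = Diag (\<chi> i. sqrt (v $ i))" unfolding D0 V by (rule mat_sqrt_Diag[OF v])
    then have d: "d = (\<chi> i. sqrt (v $ i))" by (simp add: d0 vec_eq_iff)
    have Dd: "D = Diag d" by (simp add: D d)
    have dp: "d \<in> pos_vecs" using vi by (simp add: d pos_vecs_def)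
    have dd: "d * d = v" using vi by (simp add: d vec_eq_iff less_imp_le)
    have "omega (Diag d ** C ** Diag d ** Diag d ** C ** Diag d)
        \<le> omega (Diag e ** C ** Diag e ** Diag e ** C ** Diag e)" if "e \<in> pos_vecs" for e
      by (rule omega_minimal[OF C dp that]) (use eq in \<open>simp add: dd BC\<close>)
    then have am: "is_arg_min (\<lambda>e. omega (Diag e ** C ** Diag e ** Diag e ** C ** Diag e))
            (\<lambda>e. e \<in> pos_vecs) d"
      using dp by (auto simp: is_arg_min_linorder)
    have "matrix_inv (scaled (Diag e) A) ** matrix_inv (scaled (Diag e) A)
        = Diag e ** C ** Diag e ** Diag e ** C ** Diag e" if "e \<in> pos_vecs" for e
      using that inv_scaled_Diag[OF invA, of e]
      by (simp add: C_def matrix_mul_assoc pos_vecs_def less_imp_neq[THEN not_sym])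
    then have am2: "is_arg_min
            (\<lambda>e. omega (matrix_inv (scaled (Diag e) A) ** matrix_inv (scaled (Diag e) A)))
            (\<lambda>e. e \<in> pos_vecs) d"
      using am by (auto simp: is_arg_min_linorder)
    have "invertible D"
      using matrix_inv_Diag(1)[of d] dp matrix_left_right_inverse[of D]
      by (auto simp: Dd invertible_def pos_vecs_def less_imp_neq[THEN not_sym])
    then have sys: "\<forall>x b. A *v x = b \<longleftrightarrow> scaled D A *v (D *v x) = matrix_inv D *v b"
      using scaled_system_iff by blast
    have "v \<bullet> (B *v v) = real CARD('n)"
      using vi by (simp add: inner_vec_def eq less_imp_neq[THEN not_sym])
    moreover have "diag (matrix_inv V) \<in> pos_vecs"
      using vi by (simp add: V diag_inv[OF v] pos_vecs_def)
    ultimately show ?thesis using eq Dd am am2 sys by blast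
  qed
  show ?thesis
    unfolding C_def[symmetric]
  proof (rule conjI[OF B], rule conjI[OF _ conjI[OF ex1]])
    show "\<forall>i j. B $ i $ j \<ge> 0" using nonneg by blast
  qed (intro allI impI, rule main; assumption)
qed

end
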